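(* Let $m,n$ be positive integers with $m \leq n = 2^r$ for some positive integer $r$. Then there is a Parseval frame for $\mathbb{C}^m$ defined by a matrix $V = [\mathbf{v}_1,\ldots,\mathbf{v}_n] = [v_{ij}] \in \mathbb{C}^{m\times n}$ such that $v_{ij} \in \{1/\sqrt{n}, -1/\sqrt{n}\}$ for all $i=1,\ldots,m$ and $j=1,\ldots,n$, and $\|\mathbf{v}_j\| = \sqrt{m/n}$ for each $j=1,\ldots,n$.
   Context: A finite family $\mathbf{v}_1,\ldots,\mathbf{v}_n \in \mathbb{C}^m$ is a Parseval frame for $\mathbb{C}^m$ if $\sum_{j=1}^n |\mathbf{v}_j^*\mathbf{x}|^2 = 1$ for all $\mathbf{x}\in\mathbb{C}^m$ with $\|\mathbf{x}\|=1$; equivalently $VV^* = I_m$ where $V=[\mathbf{v}_1,\ldots,\mathbf{v}_n]$ has the $\mathbf{v}_j$ as columns. Here $^*$ denotes conjugate transpose and $\|\cdot\|$ the Euclidean norm. *)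

theory Defs
  imports "HOL-Analysis.Analysis"
begin

(* v^* x; the library inner product on complex ^ 'm is real-valued (its real part). *)
definition herm_prod :: "complex ^ 'm \<Rightarrow> complex ^ 'm \<Rightarrow> complex"
  where "herm_prod v x = (\<Sum>i\<in>UNIV. cnj (v $ i) * x $ i)"

definition parseval_frame :: "('n::finite \<Rightarrow> complex ^ 'm) \<Rightarrow> bool"
  where "parseval_frame v \<longleftrightarrow>
    (\<forall>x. norm x = 1 \<longrightarrow> (\<Sum>j\<in>UNIV. (cmod (herm_prod (v j) x))\<^sup>2) = 1)"

end

theory Submission
  imports Defs
begin

text \<open>
  A family is a Parseval frame as soon as the rows of the matrix having the family as columns are
  orthonormal, because then \<open>V V\<^sup>* = I\<close>.  Orthonormality of rows survives deleting rows, so it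
  suffices to have an orthogonal family of \<open>2 ^ r\<close> sign vectors of length \<open>2 ^ r\<close>, keep any
  \<open>m\<close> of them, and scale by \<open>1 / sqrt n\<close>; the column norms are then forced, since all entries
  have the same modulus.

  The sign vectors are the Walsh functions, that is, the characters of the group of subsets of an
  \<open>r\<close>-element set under symmetric difference (the rows of the Sylvester-Hadamard matrix).
  Rows and columns are labelled by subsets \<open>A\<close>, \<open>B\<close>, and the entry is
  \<open>(-1) ^ card (A \<inter> B)\<close>.  Two distinct rows \<open>A\<close>, \<open>A'\<close> are orthogonal because toggling
  in \<open>B\<close> an element of the symmetric difference of \<open>A\<close> and \<open>A'\<close> flips the sign of
  exactly one of the two factors; this is \<open>walsh_orthogonal\<close>.  The labelling by subsets makes
  this cancellation uniform in \<open>r\<close>, where the block recursion would call for induction.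
\<close>

definition walsh :: "'a set \<Rightarrow> 'a set \<Rightarrow> real"
  where "walsh A B = (- 1) ^ card (A \<inter> B)"

definition toggle :: "'a \<Rightarrow> 'a set \<Rightarrow> 'a set"
  where "toggle s B = (if s \<in> B then B - {s} else insert s B)"

lemma walsh_square: "walsh A B * walsh A B = 1"
  by (simp add: walsh_def flip: power_add mult_2)

lemma walsh_cases: "walsh A B = 1 \<or> walsh A B = - 1"
  by (cases "even (card (A \<inter> B))") (auto simp: walsh_def)

lemma walsh_toggle:
  assumes "finite A"
  shows "walsh A (toggle s B) = (if s \<in> A then - walsh A B else walsh A B)"
proof (cases "s \<in> A")
  case False
  then have "A \<inter> toggle s B = A \<inter> B"
    by (auto simp: toggle_def)
  with False show ?thesis
    by (simp add: walsh_def)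
next
  case True
  have *: "walsh A (insert s C) = - walsh A C" if "s \<notin> C" for C
  proof -
    have "A \<inter> insert s C = insert s (A \<inter> C)"
      using True by auto
    with that assms show ?thesis
      by (simp add: walsh_def)
  qed
  show ?thesis
  proof (cases "s \<in> B")
    case True
    with *[of "B - {s}"] \<open>s \<in> A\<close> show ?thesis
      by (simp add: toggle_def insert_absorb)
  qed (use * True in \<open>simp add: toggle_def\<close>)
qed

text \<open>
  Toggling an element on which \<open>A\<close> and \<open>A'\<close> disagree is an involution of the summation
  range that negates every summand, so the sum equals its own negative.
\<close>

lemma walsh_orthogonal:
  assumes "finite S" "A \<subseteq> S" "A' \<subseteq> S" "A \<noteq> A'"
  shows "(\<Sum>B\<in>Pow S. walsh A B * walsh A' B) = 0"
proof -
  obtain s where s: "s \<in> S" "s \<in> A \<longleftrightarrow> s \<notin> A'"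
    using assms by blast
  have fin: "finite A" "finite A'"
    using assms finite_subset by blast+
  have toggle: "toggle s B \<in> Pow S" "toggle s (toggle s B) = B" if "B \<in> Pow S" for B
    using s that by (auto simp: toggle_def)
  have flip: "- (walsh A (toggle s B) * walsh A' (toggle s B)) = walsh A B * walsh A' B" for B
    using s by (auto simp: walsh_toggle fin)
  have "(\<Sum>B\<in>Pow S. walsh A B * walsh A' B) = (\<Sum>B\<in>Pow S. - (walsh A B * walsh A' B))"
    by (rule sum.reindex_bij_witness[where i = "toggle s" and j = "toggle s"])
      (simp_all only: toggle flip)
  then show ?thesis
    by (simp add: sum_negf)
qed

lemma parseval_frame_columns_if_rows_orthonormal:
  fixes V :: "complex ^ 'n::finite ^ 'm::finite"
  assumes "\<And>i k. (\<Sum>j\<in>UNIV. cnj (V $ i $ j) * V $ k $ j) = (if i = k then 1 else 0)"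
  shows "parseval_frame (\<lambda>j. column j V)"
  unfolding parseval_frame_def
proof (intro allI impI)
  fix x :: "complex ^ 'm"
  assume x: "norm x = 1"
  have "complex_of_real (\<Sum>j\<in>UNIV. (cmod (herm_prod (column j V) x))\<^sup>2)
      = (\<Sum>j\<in>UNIV. herm_prod (column j V) x * cnj (herm_prod (column j V) x))"
    by (simp only: of_real_sum complex_norm_square)
  also have "\<dots> = (\<Sum>j\<in>UNIV. \<Sum>i\<in>UNIV. \<Sum>k\<in>UNIV.
      x $ i * cnj (x $ k) * (cnj (V $ i $ j) * V $ k $ j))"
    by (simp add: herm_prod_def column_def sum_product mult_ac)
  also have "\<dots> = (\<Sum>i\<in>UNIV. \<Sum>k\<in>UNIV. \<Sum>j\<in>UNIV.
      x $ i * cnj (x $ k) * (cnj (V $ i $ j) * V $ k $ j))"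
    by (subst sum.swap, rule sum.cong[OF refl], rule sum.swap)
  also have "\<dots> = (\<Sum>i\<in>UNIV. \<Sum>k\<in>UNIV. x $ i * cnj (x $ k) * (if i = k then 1 else 0))"
    by (simp only: assms flip: sum_distrib_left)
  also have "\<dots> = (\<Sum>i\<in>UNIV. x $ i * cnj (x $ i))"
    by (simp add: if_distrib cong: if_cong)
  also have "\<dots> = complex_of_real ((norm x)\<^sup>2)"
    by (simp add: norm_vec_def L2_set_def sum_nonneg flip: complex_norm_square)
  finally show "(\<Sum>j\<in>UNIV. (cmod (herm_prod (column j V) x))\<^sup>2) = 1"
    using x by (simp only: of_real_eq_iff) simp
qed

theorem mainTheorem3:
  fixes r :: nat
  assumes "r > 0"
    and "CARD('n::finite) = 2 ^ r"
    and "CARD('m::finite) \<le> CARD('n)"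
  shows "\<exists>V :: complex ^ 'n ^ 'm.
    parseval_frame (\<lambda>j. column j V) \<and>
    (\<forall>i j. V $ i $ j \<in> {complex_of_real (1 / sqrt (real CARD('n))),
                        complex_of_real (- 1 / sqrt (real CARD('n)))}) \<and>
    (\<forall>j. norm (column j V) = sqrt (real CARD('m) / real CARD('n)))"
proof -
  let ?n = "real CARD('n)"
  define S where "S = {..<r}"
  have S: "finite S" and card_Pow_S: "card (Pow S) = CARD('n)"
    using assms(2) by (simp_all add: S_def card_Pow)
  obtain b :: "'n \<Rightarrow> nat set" where b: "bij_betw b UNIV (Pow S)"
    using finite_same_card_bij[of "UNIV :: 'n set" "Pow S"] S card_Pow_S by auto
  obtain a :: "'m \<Rightarrow> nat set" where a: "inj a" "range a \<subseteq> Pow S"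
    using card_le_inj[of "UNIV :: 'm set" "Pow S"] S card_Pow_S assms(3) by auto
  define V :: "complex ^ 'n ^ 'm"
    where "V = (\<chi> i j. complex_of_real (walsh (a i) (b j) / sqrt ?n))"
  have V: "V $ i $ j = complex_of_real (walsh (a i) (b j) / sqrt ?n)" for i j
    by (simp add: V_def)
  have "(\<Sum>j\<in>UNIV. cnj (V $ i $ j) * V $ k $ j) = (if i = k then 1 else 0)" for i k
  proof -
    have "(\<Sum>j\<in>UNIV. cnj (V $ i $ j) * V $ k $ j)
        = complex_of_real ((\<Sum>j\<in>UNIV. walsh (a i) (b j) * walsh (a k) (b j)) / ?n)"
      by (simp add: V sum_divide_distrib flip: of_real_mult of_real_divide)
    also have "(\<Sum>j\<in>UNIV. walsh (a i) (b j) * walsh (a k) (b j))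
        = (\<Sum>B\<in>Pow S. walsh (a i) B * walsh (a k) B)"
      by (rule sum.reindex_bij_betw[OF b])
    also have "\<dots> = (if i = k then ?n else 0)"
    proof (cases "i = k")
      case True
      then show ?thesis
        by (simp add: walsh_square card_Pow_S)
    next
      case False
      then have "a i \<noteq> a k" "a i \<subseteq> S" "a k \<subseteq> S"
        using a by (auto dest: injD)
      with False S show ?thesis
        by (simp add: walsh_orthogonal)
    qed
    finally show ?thesis
      by simp
  qed
  then have "parseval_frame (\<lambda>j. column j V)"
    by (rule parseval_frame_columns_if_rows_orthonormal)
  moreover have "V $ i $ j \<in> {complex_of_real (1 / sqrt ?n), complex_of_real (- 1 / sqrt ?n)}"
    for i j
    using walsh_cases[of "a i" "b j"] by (auto simp: V)
  moreover have "norm (column j V) = sqrt (real CARD('m) / ?n)" for j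
  proof -
    have "(cmod (V $ i $ j))\<^sup>2 = 1 / ?n" for i
      unfolding V norm_of_real
      by (simp add: power_divide power2_eq_square walsh_square)
    then show ?thesis
      by (simp add: norm_vec_def L2_set_def column_def)
  qed
  ultimately show ?thesis
    by blast
qed

end
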